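(* Let $\mathbf u_1,\ldots,\mathbf u_n$ be nonzero vectors in $\mathbb R^n$, let $1\le k\le n-1$ be fixed, and let $\lambda\ne\tfrac12$ be a fixed real number. The following are equivalent. (i) The vectors $\mathbf u_1,\ldots,\mathbf u_n$ are mutually perpendicular. (ii) For every $k$-dimensional linear subspace $L$ of $\mathbb R^n$ (through $S$), $$\sum_{i=1}^{n}\frac{B_iH_i^2}{SA_i^2}=n\lambda^2-2k\lambda+k.$$ (iii) For every line $L$ through $S$, $$\sum_{i=1}^{n}\frac{SH_i^2}{SA_i^2}=1.$$ In particular, when these conditions hold, the vectors are automatically linearly independent.
   Context: $S$ is the origin of Euclidean space $\mathbb R^n$ and $A_i=S+\mathbf u_i$, so $SA_i=\lVert\mathbf u_i\rVert$. In each of (ii) and (iii), $H_i$ denotes the orthogonal projection of $A_i$ onto the subspace $L$ in question, and $B_i$ is the point with $\overrightarrow{SB_i}=\lambda\mathbf u_i$. For points $X,Y$, $XY$ denotes their Euclidean distance. *)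

theory Defs
  imports "HOL-Analysis.Analysis"
begin

definition orth_proj :: "'a::euclidean_space set \<Rightarrow> 'a \<Rightarrow> 'a" where
  "orth_proj L x = (THE h. h \<in> L \<and> (\<forall>y\<in>L. orthogonal (x - h) y))"

lemma orth_proj_ex1:
  fixes L :: "'a::euclidean_space set"
  assumes "subspace L"
  shows "\<exists>!h. h \<in> L \<and> (\<forall>y\<in>L. orthogonal (x - h) y)"
proof -
  obtain y z where yz: "y \<in> span L" "\<And>w. w \<in> span L \<Longrightarrow> orthogonal z w" "x = y + z"
    using orthogonal_subspace_decomp_exists by blast
  have span: "span L = L"
    using assms by (simp add: span_eq_iff)
  show ?thesis
  proof (rule ex1I[of _ y])
    show "y \<in> L \<and> (\<forall>w\<in>L. orthogonal (x - y) w)"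
      using yz span by simp
  next
    fix h assume h: "h \<in> L \<and> (\<forall>y\<in>L. orthogonal (x - h) y)"
    have "y - h \<in> L"
      using h yz(1) span assms by (simp add: subspace_diff)
    then have "(x - h) \<bullet> (y - h) = 0" "z \<bullet> (y - h) = 0"
      using h yz(2) span by (auto simp: orthogonal_def)
    then have "(y - h) \<bullet> (y - h) = 0"
      using yz(3) by (simp add: algebra_simps)
    then show "h = y" by simp
  qed
qed

lemma orth_proj:
  fixes L :: "'a::euclidean_space set"
  assumes "subspace L"
  shows "orth_proj L x \<in> L" and "y \<in> L \<Longrightarrow> orthogonal (x - orth_proj L x) y"
  using theI'[OF orth_proj_ex1[OF assms, of x]] by (auto simp: orth_proj_def)

end

theory Submission
  imports Defs
begin

text \<open>
  For nonzero \<open>u i\<close> let \<open>q x\<close> be the sum over \<open>i\<close> of \<open>(u i \<bullet> x)\<^sup>2 / (norm (u i))\<^sup>2\<close>, the quadratic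
  form that adds up the squared coordinates of \<open>x\<close> along the directions of the \<open>u i\<close>.
  If \<open>C\<close> is an orthonormal basis of a subspace \<open>L\<close>, then the squared length of the projection of a
  vector to \<open>L\<close> is the sum of its squared coordinates along \<open>C\<close>; exchanging the two sums, the
  relative squared projections of all the \<open>u i\<close> add up to the sum of \<open>q\<close> over \<open>C\<close>
  (\<open>sum_orth_proj_eq_sum_direction_form\<close>). The orthogonal decomposition of \<open>u i\<close> turns each
  summand of the condition on \<open>k\<close>-dimensional subspaces into \<open>\<lambda>\<^sup>2 + (1 - 2\<lambda>)\<close> times the relative
  squared projection (\<open>dist_scaled_orth_proj\<close>). As \<open>\<lambda> \<noteq> 1/2\<close>, that condition says exactly that \<open>q\<close>
  adds up to \<open>k\<close> over every orthonormal \<open>k\<close>-set, and the condition on lines says that \<open>q\<close> is \<open>1\<close> on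
  unit vectors.

  It remains to compare three properties of \<open>q\<close>. If the \<open>u i\<close> are orthogonal, then their directions
  form an orthonormal basis, because there are as many of them as dimensions, and \<open>q x\<close> is
  \<open>(norm x)\<^sup>2\<close> by Parseval (\<open>direction_form_orthogonal\<close>); so both conditions hold.
  If \<open>q\<close> adds up to \<open>k\<close> over orthonormal \<open>k\<close>-sets with \<open>k\<close> less than the dimension, exchanging one
  member of such a set for another unit vector shows that \<open>q\<close> is constant on every orthonormal basis,
  hence \<open>1\<close> on unit vectors (\<open>unit_value_if_orthonormal_sums\<close>). Finally, if \<open>q\<close> is \<open>1\<close> on unit vectors,
  then at the direction of \<open>u j\<close> the \<open>j\<close>-th term already contributes \<open>1\<close>, so the other
  terms vanish, which is orthogonality (\<open>orthogonal_if_direction_form_unit\<close>).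
\<close>

section \<open>Orthonormal sets and projections\<close>

definition orthonormal :: "'a::euclidean_space set \<Rightarrow> bool" where
  "orthonormal C \<longleftrightarrow> pairwise orthogonal C \<and> (\<forall>c\<in>C. norm c = 1)"

lemma orthonormal_subset: "orthonormal C \<Longrightarrow> D \<subseteq> C \<Longrightarrow> orthonormal D"
  by (auto simp: orthonormal_def intro: pairwise_subset)

lemma orthonormal_finite: "orthonormal C \<Longrightarrow> finite C"
  by (simp add: orthonormal_def pairwise_orthogonal_imp_finite)

lemma orthonormal_independent: "orthonormal C \<Longrightarrow> independent C"
  by (metis orthonormal_def pairwise_orthogonal_independent norm_zero zero_neq_one)

lemma norm_sum_orthonormal:
  assumes "orthonormal C"
  shows "(norm (\<Sum>c\<in>C. a c *\<^sub>R c))\<^sup>2 = (\<Sum>c\<in>C. (a c)\<^sup>2)"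
proof -
  have "pairwise (\<lambda>c d. orthogonal (a c *\<^sub>R c) (a d *\<^sub>R d)) C"
    using assms by (auto simp: orthonormal_def pairwise_def orthogonal_def)
  from norm_sum_Pythagorean[OF orthonormal_finite[OF assms] this]
  show ?thesis using assms by (simp add: orthonormal_def)
qed

lemma parseval:
  assumes "orthonormal C" and "x \<in> span C"
  shows "(norm x)\<^sup>2 = (\<Sum>c\<in>C. (x \<bullet> c)\<^sup>2)"
  using orthonormal_basis_expand[of C x] norm_sum_orthonormal[OF assms(1), of "\<lambda>c. x \<bullet> c"]
    assms orthonormal_finite[OF assms(1)]
  by (simp add: orthonormal_def)

lemma norm_orth_proj_span:
  assumes "orthonormal C"
  shows "(norm (orth_proj (span C) x))\<^sup>2 = (\<Sum>c\<in>C. (x \<bullet> c)\<^sup>2)"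
proof -
  have "orth_proj (span C) x \<bullet> c = x \<bullet> c" if "c \<in> C" for c
    using orth_proj(2)[OF subspace_span span_base[OF that], of x]
    by (simp add: orthogonal_def inner_diff_left)
  then show ?thesis
    using parseval[OF assms orth_proj(1)[OF subspace_span], of x] by simp
qed

text \<open>
  The reason is that \<open>x \<bullet> P x = (norm (P x))\<^sup>2\<close> for the projection \<open>P\<close>, so expanding the square
  leaves nothing but multiples of \<open>(norm x)\<^sup>2\<close> and \<open>(norm (P x))\<^sup>2\<close>.
\<close>

lemma dist_scaled_orth_proj:
  fixes x :: "'a::euclidean_space"
  assumes "subspace L"
  shows "(dist (lam *\<^sub>R x) (orth_proj L x))\<^sup>2 =
    lam\<^sup>2 * (norm x)\<^sup>2 + (1 - 2 * lam) * (norm (orth_proj L x))\<^sup>2"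
proof -
  let ?p = "orth_proj L x"
  have "x \<bullet> ?p = ?p \<bullet> ?p"
    using orth_proj(2)[OF assms orth_proj(1)[OF assms], of x x]
    by (simp add: orthogonal_def inner_diff_left)
  then show ?thesis
    unfolding dist_norm power2_norm_eq_inner
    by (simp add: inner_commute[of ?p x] algebra_simps
        power2_eq_square)
qed

section \<open>Projections and the quadratic form of the directions\<close>

definition direction_form :: "('i::finite \<Rightarrow> 'a::euclidean_space) \<Rightarrow> 'a \<Rightarrow> real" where
  "direction_form u x = (\<Sum>i\<in>UNIV. (u i \<bullet> x)\<^sup>2 / (norm (u i))\<^sup>2)"

lemma sum_orth_proj_eq_sum_direction_form:
  assumes "orthonormal C"
  shows "(\<Sum>i\<in>UNIV. (norm (orth_proj (span C) (u i)))\<^sup>2 / (norm (u i))\<^sup>2)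
    = (\<Sum>c\<in>C. direction_form u c)"
proof -
  have "(\<Sum>i\<in>UNIV. (norm (orth_proj (span C) (u i)))\<^sup>2 / (norm (u i))\<^sup>2)
      = (\<Sum>i\<in>UNIV. \<Sum>c\<in>C. (u i \<bullet> c)\<^sup>2 / (norm (u i))\<^sup>2)"
    by (simp add: norm_orth_proj_span[OF assms] sum_divide_distrib)
  also have "\<dots> = (\<Sum>c\<in>C. direction_form u c)"
    unfolding direction_form_def by (rule sum.swap)
  finally show ?thesis .
qed

text \<open>
  Every subspace has an orthonormal basis, so quantifying over subspaces of dimension \<open>k\<close> is the same
  as quantifying over orthonormal sets of size \<open>k\<close>. In this form the subspaces can be
  exchanged vector by vector.
\<close>

lemma all_subspaces_iff_all_orthonormal:
  fixes u :: "'i::finite \<Rightarrow> 'a::euclidean_space"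
  shows "(\<forall>L. subspace L \<and> dim L = k \<longrightarrow>
      (\<Sum>i\<in>UNIV. (norm (orth_proj L (u i)))\<^sup>2 / (norm (u i))\<^sup>2) = s) \<longleftrightarrow>
    (\<forall>C. orthonormal C \<and> card C = k \<longrightarrow> (\<Sum>c\<in>C. direction_form u c) = s)"
    (is "?subspaces \<longleftrightarrow> ?sets")
proof
  assume subspaces: ?subspaces
  show ?sets
  proof (intro allI impI, elim conjE)
    fix C :: "'a set" assume C: "orthonormal C" "card C = k"
    then have "dim (span C) = k"
      by (simp only: dim_span_eq_card_independent[OF orthonormal_independent])
    then show "(\<Sum>c\<in>C. direction_form u c) = s"
      using subspaces sum_orth_proj_eq_sum_direction_form[OF C(1), of u] subspace_span by metis
  qed
next
  assume sets: ?sets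
  show ?subspaces
  proof (intro allI impI, elim conjE)
    fix L :: "'a set" assume "subspace L" "dim L = k"
    then obtain C where "orthonormal C" "card C = k" "span C = L"
      using orthonormal_basis_subspace[of L] unfolding orthonormal_def by metis
    then show "(\<Sum>i\<in>UNIV. (norm (orth_proj L (u i)))\<^sup>2 / (norm (u i))\<^sup>2) = s"
      using sets sum_orth_proj_eq_sum_direction_form[of C u] by auto
  qed
qed

section \<open>Orthogonality and the values of the form\<close>

lemma inj_orthogonal_family:
  assumes "\<And>i. u i \<noteq> 0" and "\<And>i j. i \<noteq> j \<Longrightarrow> orthogonal (u i) (u j)"
  shows "inj u"
  using assms by (metis injI orthogonal_self)

text \<open>
  The normalised family has as many members as there are dimensions, so it is a basis of the
  whole space and Parseval's identity applies to every \<open>x\<close>.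
\<close>

lemma direction_form_orthogonal:
  fixes u :: "'i::finite \<Rightarrow> 'a::euclidean_space"
  assumes nz: "\<And>i. u i \<noteq> 0"
    and orth: "\<And>i j. i \<noteq> j \<Longrightarrow> orthogonal (u i) (u j)"
    and card: "CARD('i) = DIM('a)"
  shows "direction_form u x = (norm x)\<^sup>2"
proof -
  define e where "e i = sgn (u i)" for i
  have e_orth: "orthogonal (e i) (e j)" if "i \<noteq> j" for i j
    using orth[OF that] by (simp add: e_def sgn_div_norm orthogonal_def)
  have "e i \<noteq> 0" for i
    using nz by (simp add: e_def sgn_zero_iff)
  then have inj: "inj e"
    by (rule inj_orthogonal_family) (rule e_orth)
  have on: "orthonormal (range e)"
    unfolding orthonormal_def
  proof
    show "pairwise orthogonal (range e)"
      unfolding pairwise_def using e_orth by (metis imageE)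
    show "\<forall>c\<in>range e. norm c = 1"
      using nz by (simp add: e_def norm_sgn)
  qed
  have "card (range e) = DIM('a)"
    using inj card by (simp add: card_image)
  then have "span (range e) = UNIV"
    using card_ge_dim_independent[of "range e" UNIV] orthonormal_independent[OF on] by auto
  then have "(norm x)\<^sup>2 = (\<Sum>c\<in>range e. (x \<bullet> c)\<^sup>2)"
    using parseval[OF on] by simp
  also have "\<dots> = (\<Sum>i\<in>UNIV. (x \<bullet> e i)\<^sup>2)"
    using inj by (simp add: sum.reindex)
  also have "\<dots> = direction_form u x"
    by (simp add: direction_form_def e_def sgn_div_norm power_mult_distrib inner_commute
        divide_inverse mult.commute power_inverse)
  finally show ?thesis by simp
qed

text \<open>
  Two members \<open>x\<close>, \<open>y\<close> of an orthonormal basis can both be completed by the same \<open>k - 1\<close> further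
  members, because \<open>k\<close> is less than the dimension. Comparing the two sums shows that \<open>f\<close> takes the
  same value at \<open>x\<close> and \<open>y\<close>, so every one of \<open>k\<close> equal terms adding up to \<open>k\<close> is \<open>1\<close>. For \<open>k\<close> equal
  to the dimension this fails: the sum of a quadratic form over an orthonormal basis is its
  trace, whatever the form.
\<close>

lemma unit_value_if_orthonormal_sums:
  fixes f :: "'a::euclidean_space \<Rightarrow> real"
  assumes sums: "\<And>C. orthonormal C \<Longrightarrow> card C = k \<Longrightarrow> (\<Sum>c\<in>C. f c) = real k"
    and k: "1 \<le> k" "k < DIM('a)"
    and x: "norm x = 1"
  shows "f x = 1"
proof -
  obtain E where E: "x \<in> E" "orthonormal E" "card E = DIM('a)"
    using vector_in_orthonormal_basis[OF x] by (metis orthonormal_def)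
  have finE: "finite E"
    by (rule orthonormal_finite) fact
  have const: "f y = f x" if y: "y \<in> E" for y
  proof (cases "y = x")
    case False
    have "card (E - {x, y}) = DIM('a) - 2"
      using E y False finE by (simp add: card_Diff_subset)
    then have "k - 1 \<le> card (E - {x, y})"
      using k by simp
    then obtain T where T: "T \<subseteq> E - {x, y}" "card T = k - 1" "finite T"
      by (rule obtain_subset_with_card_n)
    have "f z + sum f T = real k" if "z = x \<or> z = y" for z
    proof -
      have "z \<notin> T" "insert z T \<subseteq> E"
        using that T E(1) y by auto
      then show ?thesis
        using sums[of "insert z T"] orthonormal_subset[OF E(2)] T k by simp
    qed
    from this[of x] this[of y] show ?thesis by simp
  qed simp
  obtain T where T: "T \<subseteq> E" "card T = k"
    using obtain_subset_with_card_n[of k E] E(3) k by auto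
  have "real k = (\<Sum>c\<in>T. f c)"
    using sums[of T] orthonormal_subset[OF E(2)] T by simp
  also have "\<dots> = real k * f x"
    using const T by (simp add: subset_iff)
  finally show ?thesis using k by simp
qed

text \<open>
  At the unit vector in the direction of \<open>u j\<close>, the \<open>j\<close>-th term of the form alone equals \<open>1\<close>; all
  terms are nonnegative, so the remaining ones are zero.
\<close>

lemma orthogonal_if_direction_form_unit:
  fixes u :: "'i::finite \<Rightarrow> 'a::euclidean_space"
  assumes nz: "\<And>i. u i \<noteq> 0"
    and unit: "\<And>x. norm x = 1 \<Longrightarrow> direction_form u x = 1"
    and ij: "i \<noteq> j"
  shows "orthogonal (u i) (u j)"
proof -
  let ?e = "sgn (u j)"
  let ?t = "\<lambda>i. (u i \<bullet> ?e)\<^sup>2 / (norm (u i))\<^sup>2"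
  have "u j \<bullet> ?e = norm (u j)"
    using nz[of j] by (simp add: sgn_div_norm dot_square_norm power2_eq_square)
  then have "?t j = 1"
    using nz[of j] by simp
  moreover have "(\<Sum>i\<in>UNIV. ?t i) = 1"
    using unit[of ?e] nz[of j] by (simp add: direction_form_def norm_sgn)
  moreover have "(\<Sum>i\<in>UNIV. ?t i) = ?t j + (\<Sum>i\<in>UNIV - {j}. ?t i)"
    by (rule sum.remove) auto
  ultimately have "(\<Sum>i\<in>UNIV - {j}. ?t i) = 0"
    by linarith
  then have "?t i = 0"
    using ij by (subst (asm) sum_nonneg_eq_0_iff) auto
  then show ?thesis
    using nz by (simp add: sgn_div_norm orthogonal_def)
qed

section \<open>The characterisation of orthogonality\<close>

theorem theorem5p1:
  fixes u :: "'n::finite \<Rightarrow> real ^ 'n"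
    and S :: "real ^ 'n"
    and A B :: "'n \<Rightarrow> real ^ 'n"
    and k :: nat
    and lam :: real
  assumes "\<And>i. u i \<noteq> 0"
    and "1 \<le> k" and "k \<le> CARD('n) - 1"
    and "lam \<noteq> 1 / 2"
    and "S = 0"
    and "\<And>i. A i = S + u i"
    and "\<And>i. B i = S + lam *\<^sub>R u i"
  shows "((\<forall>i j. i \<noteq> j \<longrightarrow> orthogonal (u i) (u j)) \<longleftrightarrow>
          (\<forall>L. subspace L \<and> dim L = k \<longrightarrow>
            (\<Sum>i\<in>UNIV. (dist (B i) (orth_proj L (A i)))\<^sup>2 / (dist S (A i))\<^sup>2)
              = real CARD('n) * lam\<^sup>2 - 2 * real k * lam + real k))
       \<and> ((\<forall>i j. i \<noteq> j \<longrightarrow> orthogonal (u i) (u j)) \<longleftrightarrow>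
          (\<forall>L. subspace L \<and> dim L = 1 \<longrightarrow>
            (\<Sum>i\<in>UNIV. (dist S (orth_proj L (A i)))\<^sup>2 / (dist S (A i))\<^sup>2) = 1))
       \<and> ((\<forall>i j. i \<noteq> j \<longrightarrow> orthogonal (u i) (u j)) \<longrightarrow> inj u \<and> independent (range u))"
proof -
  let ?orth = "\<forall>i j. i \<noteq> j \<longrightarrow> orthogonal (u i) (u j)"
  let ?proj = "\<lambda>L. \<Sum>i\<in>UNIV. (norm (orth_proj L (u i)))\<^sup>2 / (norm (u i))\<^sup>2"
  let ?bh = "\<lambda>L. \<Sum>i\<in>UNIV. (dist (B i) (orth_proj L (A i)))\<^sup>2 / (dist S (A i))\<^sup>2"
  let ?r = "real CARD('n) * lam\<^sup>2 - 2 * real k * lam + real k"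
  let ?sums = "\<lambda>k. \<forall>C. orthonormal C \<and> card C = k \<longrightarrow> (\<Sum>c\<in>C. direction_form u c) = real k"
  note nz = assms(1)
  have k: "k < DIM(real ^ 'n)"
    using assms(2,3) by simp
  have iii: "(\<Sum>i\<in>UNIV. (dist S (orth_proj L (A i)))\<^sup>2 / (dist S (A i))\<^sup>2) = ?proj L" for L
    using assms(5,6) by simp
  have ii: "?bh L = ?r \<longleftrightarrow> ?proj L = real k" if "subspace L" for L
  proof -
    have "?bh L
        = (\<Sum>i\<in>UNIV. lam\<^sup>2 + (1 - 2 * lam) * ((norm (orth_proj L (u i)))\<^sup>2 / (norm (u i))\<^sup>2))"
      using nz assms(5-7) by (simp add: dist_scaled_orth_proj[OF that] add_divide_distrib)
    also have "\<dots> = real CARD('n) * lam\<^sup>2 + (1 - 2 * lam) * ?proj L"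
      by (simp add: sum.distrib sum_distrib_left)
    finally have eq: "?bh L - ?r = (1 - 2 * lam) * (?proj L - real k)"
      by (simp add: algebra_simps)
    have "1 - 2 * lam \<noteq> 0"
      using assms(4) by simp
    then show ?thesis
      unfolding eq_iff_diff_eq_0[of "?bh L" ?r] eq by simp
  qed
  have orth_imp: "?sums m" if "?orth" for m
  proof (intro allI impI, elim conjE)
    fix C :: "(real ^ 'n) set" assume C: "orthonormal C" "card C = m"
    have "direction_form u c = 1" if "c \<in> C" for c
      using direction_form_orthogonal[of u c] nz \<open>?orth\<close> C that by (simp add: orthonormal_def)
    then show "(\<Sum>c\<in>C. direction_form u c) = real m"
      using C by simp
  qed
  have imp_orth: "?orth" if sums: "?sums m" and m: "1 \<le> m" "m < DIM(real ^ 'n)" for m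
  proof -
    have "direction_form u x = 1" if "norm x = 1" for x
      using unit_value_if_orthonormal_sums[of m "direction_form u"] sums m that by blast
    then show ?thesis
      using orthogonal_if_direction_form_unit[of u] nz by blast
  qed
  have sums: "?sums m \<longleftrightarrow> (\<forall>L. subspace L \<and> dim L = m \<longrightarrow> ?proj L = real m)" for m
    by (rule all_subspaces_iff_all_orthonormal[symmetric])
  have "?orth \<longleftrightarrow> (\<forall>L. subspace L \<and> dim L = k \<longrightarrow> ?proj L = real k)"
    using orth_imp[of k] imp_orth[of k] assms(2) k sums[of k] by blast
  also have "\<dots> \<longleftrightarrow> (\<forall>L. subspace L \<and> dim L = k \<longrightarrow> ?bh L = ?r)"
    using ii by blast
  finally have all_k: "?orth \<longleftrightarrow> (\<forall>L. subspace L \<and> dim L = k \<longrightarrow> ?bh L = ?r)" .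
  \<comment> \<open>Since \<open>1 \<le> k < n\<close>, lines too are subspaces of dimension less than \<open>n\<close>, so the exchange
    argument covers them.\<close>
  have all_lines: "?orth \<longleftrightarrow> (\<forall>L. subspace L \<and> dim L = 1 \<longrightarrow> ?proj L = 1)"
    using orth_imp[of 1] imp_orth[of 1] assms(2) k sums[of 1] by simp blast
  have indep: "?orth \<longrightarrow> inj u \<and> independent (range u)"
  proof (intro impI conjI)
    assume orth: ?orth
    show "inj u"
      using nz orth by (intro inj_orthogonal_family) auto
    show "independent (range u)"
      using nz orth by (intro pairwise_orthogonal_independent) (auto simp: pairwise_def, metis)
  qed
  show ?thesis
    unfolding iii by (intro conjI all_k all_lines indep)
qed

end
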